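(* If $N:\langle\Gamma\vdash U\rangle$ and $M\rhd_\beta N$ (one step), then $M:\langle\Gamma{\uparrow^{M}}\vdash U\rangle$.
   Context: Terms: $\mathcal V$ is a denumerably infinite set of variables; $\mathcal M$ is the set of untyped $\lambda$-terms $M::=x\mid \lambda x.M\mid MM$ taken modulo $\alpha$-conversion; $FV(M)$ is the set of free variables; $M[x:=N]$ is capture-avoiding substitution. $\rhd_\beta$ is the compatible closure of $(\lambda x.M)N\rhd_\beta M[x:=N]$. Types: $\mathcal A$ is a denumerably infinite set of atomic types; $\mathbb T::=a\mid \mathbb U\to\mathbb T$ ($a\in\mathcal A$) and $\mathbb U::=\omega\mid \mathbb U\sqcap\mathbb U\mid \mathbb T$; types are quotiented by commutativity, associativity and idempotence of $\sqcap$ and by $\omega\sqcap U=U$. $T$ ranges over $\mathbb T$, $U,V$ over $\mathbb U$. Environments: a type environment is a finite set $(x_i:U_i)_n$ of declarations with pairwise distinct variables; $dom$ is its set of variables; $\Gamma,x:U$ requires $x\notin dom(\Gamma)$; $env^M_\omega$ assigns $\omega$ to each variable of $FV(M)$ and nothing else; if $\Gamma_1=(x_i:U_i)_n,(y_j:V_j)_m$ and $\Gamma_2=(x_i:U'_i)_n,(z_k:W_k)_l$ with the $y_j$, $z_k$ all distinct, then $\Gamma_1\sqcap\Gamma_2=(x_i:U_i\sqcap U'_i)_n,(y_j:V_j)_m,(z_k:W_k)_l$. If $\Gamma=(x_i:U_i)_n$ and $\mathcal U=\{x_1,\dots,x_m\}$ with $m\ge n$, then $\Gamma{\uparrow^{\mathcal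 U}}=x_1:U_1,\dots,x_n:U_n,x_{n+1}:\omega,\dots,x_m:\omega$; when $dom(\Gamma)\subseteq FV(M)$, $\Gamma{\uparrow^M}$ means $\Gamma{\uparrow^{FV(M)}}$. Subtyping: $\sqsubseteq$ (on types, on environments, and on typings $\langle\Gamma\vdash U\rangle$) is the least relation closed under: $\Phi\sqsubseteq\Phi$; transitivity; $U_1\sqcap U_2\sqsubseteq U_1$; if $U_1\sqsubseteq V_1$ and $U_2\sqsubseteq V_2$ then $U_1\sqcap U_2\sqsubseteq V_1\sqcap V_2$; if $U_2\sqsubseteq U_1$ and $T_1\sqsubseteq T_2$ then $U_1\to T_1\sqsubseteq U_2\to T_2$; if $U_1\sqsubseteq U_2$ and $x\notin dom(\Gamma)$ then $\Gamma,x:U_1\sqsubseteq\Gamma,x:U_2$; if $U_1\sqsubseteq U_2$ and $\Gamma_2\sqsubseteq\Gamma_1$ then $\langle\Gamma_1\vdash U_1\rangle\sqsubseteq\langle\Gamma_2\vdash U_2\rangle$. Typing rules for $M:\langle\Gamma\vdash U\rangle$: (ax) $x:\langle x:T\vdash T\rangle$ for $T\in\mathbb T$; ($\omega$) $M:\langle env^M_\omega\vdash\omega\rangle$; ($\to_i$) from $M:\langle\Gamma,x:U\vdash T\rangle$ infer $\lambda x.M:\langle\Gamma\vdash U\to T\rangle$; ($\to'_i$) from $M:\langle\Gamma\vdash T\rangle$ and $x\notin dom(\Gamma)$ infer $\lambda x.M:\langle\Gamma\vdash\omega\to T\rangle$; ($\to_e$) from $M_1:\langle\Gamma_1\vdash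 U\to T\rangle$ and $M_2:\langle\Gamma_2\vdash U\rangle$ infer $M_1M_2:\langle\Gamma_1\sqcap\Gamma_2\vdash T\rangle$; ($\sqcap_i$) from $M:\langle\Gamma\vdash U_1\rangle$ and $M:\langle\Gamma\vdash U_2\rangle$ infer $M:\langle\Gamma\vdash U_1\sqcap U_2\rangle$; ($\sqsubseteq$) from $M:\langle\Gamma\vdash U\rangle$ and $\langle\Gamma\vdash U\rangle\sqsubseteq\langle\Gamma'\vdash U'\rangle$ infer $M:\langle\Gamma'\vdash U'\rangle$. *)

theory Defs
  imports "HOL-Library.Finite_Map"
begin

section \<open>Lambda-terms modulo alpha-conversion\<close>

text \<open>
  Alpha-equivalence classes of \<open>\<lambda>\<close>-terms are represented by their locally nameless forms: bound
  occurrences are de Bruijn indices, free occurrences are names. The locally closed ones (no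
  dangling index) correspond one-to-one to the classes and form the type \<open>lterm\<close>. From then on only
  the named constructors \<open>Var\<close>, \<open>App\<close>, \<open>Lam\<close> are used, where \<open>Lam x M\<close> is the class of
  \<open>\<lambda>x. M\<close>; the facts \<open>Lam_eq_iff\<close> (equality of abstractions is alpha-equivalence),
  \<open>lterm_induct\<close>, \<open>FV_simps\<close> and \<open>subst_Lam\<close> below confirm that this is the intended structure.
\<close>

type_synonym var = nat

datatype preterm = PBound nat | PFree var | PApp preterm preterm | PLam preterm

primrec closed_at :: "nat \<Rightarrow> preterm \<Rightarrow> bool" where
  "closed_at k (PBound i) \<longleftrightarrow> i < k"
| "closed_at k (PFree y) \<longleftrightarrow> True"
| "closed_at k (PApp s t) \<longleftrightarrow> closed_at k s \<and> closed_at k t"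
| "closed_at k (PLam t) \<longleftrightarrow> closed_at (Suc k) t"

primrec bind :: "nat \<Rightarrow> var \<Rightarrow> preterm \<Rightarrow> preterm" where
  "bind k x (PBound i) = PBound i"
| "bind k x (PFree y) = (if y = x then PBound k else PFree y)"
| "bind k x (PApp s t) = PApp (bind k x s) (bind k x t)"
| "bind k x (PLam t) = PLam (bind (Suc k) x t)"

text \<open>No index shifting is needed below: the substituted \<open>u\<close> is always locally closed.\<close>

primrec psubst :: "preterm \<Rightarrow> var \<Rightarrow> preterm \<Rightarrow> preterm" where
  "psubst (PBound i) x u = PBound i"
| "psubst (PFree y) x u = (if y = x then u else PFree y)"
| "psubst (PApp s t) x u = PApp (psubst s x u) (psubst t x u)"
| "psubst (PLam t) x u = PLam (psubst t x u)"

primrec pFV :: "preterm \<Rightarrow> var fset" where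
  "pFV (PBound i) = {||}"
| "pFV (PFree y) = {|y|}"
| "pFV (PApp s t) = pFV s |\<union>| pFV t"
| "pFV (PLam t) = pFV t"

lemma closed_at_mono: "closed_at k t \<Longrightarrow> k \<le> l \<Longrightarrow> closed_at l t"
  by (induction t arbitrary: k l) force+

lemma closed_at_bind: "closed_at k t \<Longrightarrow> closed_at (Suc k) (bind k x t)"
  by (induction t arbitrary: k) auto

lemma closed_at_psubst: "closed_at k t \<Longrightarrow> closed_at 0 u \<Longrightarrow> closed_at k (psubst t x u)"
  by (induction t arbitrary: k) (auto intro: closed_at_mono)

typedef lterm = "{t. closed_at 0 t}"
  morphisms rep_lterm abs_lterm
  by (rule exI[of _ "PFree 0"]) simp

setup_lifting type_definition_lterm

lift_definition Var :: "var \<Rightarrow> lterm" is PFree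
  by simp

lift_definition App :: "lterm \<Rightarrow> lterm \<Rightarrow> lterm" is PApp
  by simp

lift_definition Lam :: "var \<Rightarrow> lterm \<Rightarrow> lterm" is "\<lambda>x t. PLam (bind 0 x t)"
  by (simp add: closed_at_bind)

lift_definition FV :: "lterm \<Rightarrow> var fset" is pFV .

lift_definition subst :: "lterm \<Rightarrow> var \<Rightarrow> lterm \<Rightarrow> lterm" ("_[_ ::= _]" [1000, 0, 0] 1000)
  is psubst
  by (rule closed_at_psubst)

lemma pFV_bind: "pFV (bind k x t) = pFV t |-| {|x|}"
  by (induction t arbitrary: k) auto

lemma bind_inject: "closed_at k s \<Longrightarrow> closed_at k t \<Longrightarrow> bind k x s = bind k x t \<longleftrightarrow> s = t"
proof (induction s arbitrary: k t)
  case (PBound i) then show ?case by (cases t) auto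
next
  case (PFree y) then show ?case by (cases t) auto
next
  case (PApp s1 s2) then show ?case by (cases t) auto
next
  case (PLam s) then show ?case by (cases t) auto
qed

lemma bind_rename: "x |\<notin>| pFV t \<Longrightarrow> bind k x (psubst t y (PFree x)) = bind k y t"
  by (induction t arbitrary: k) auto

lemma psubst_fresh: "x |\<notin>| pFV t \<Longrightarrow> psubst t x u = t"
  by (induction t) auto

lemma bind_fresh: "x |\<notin>| pFV t \<Longrightarrow> bind k x t = t"
  by (induction t arbitrary: k) auto

lemma bind_psubst:
  "y \<noteq> x \<Longrightarrow> y |\<notin>| pFV u \<Longrightarrow> psubst (bind k y t) x u = bind k y (psubst t x u)"
  by (induction t arbitrary: k) (auto simp: bind_fresh)

lemma ex_bind:
  assumes "closed_at (Suc k) t" and "x |\<notin>| pFV t"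
  shows "\<exists>s. closed_at k s \<and> size s = size t \<and> bind k x s = t"
  using assms
proof (induction t arbitrary: k)
  case (PBound i)
  then show ?case
    by (intro exI[of _ "if i = k then PFree x else PBound i"]) auto
next
  case (PFree y)
  then show ?case by (intro exI[of _ "PFree y"]) auto
next
  case (PApp t1 t2)
  then obtain s1 s2 where "closed_at k s1 \<and> size s1 = size t1 \<and> bind k x s1 = t1"
    "closed_at k s2 \<and> size s2 = size t2 \<and> bind k x s2 = t2"
    by fastforce
  then show ?case by (intro exI[of _ "PApp s1 s2"]) auto
next
  case (PLam t)
  then obtain s where "closed_at (Suc k) s \<and> size s = size t \<and> bind (Suc k) x s = t"
    by fastforce
  then show ?case by (intro exI[of _ "PLam s"]) auto
qed

lemma Lam_eq_iff:
  "Lam x M = Lam y N \<longleftrightarrow> x = y \<and> M = N \<or> x \<noteq> y \<and> x |\<notin>| FV N \<and> M = N[y ::= Var x]"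
proof (transfer fixing: x y, clarsimp)
  fix M N assume cl: "closed_at 0 M" "closed_at 0 N"
  have "bind 0 x M = bind 0 y N \<longleftrightarrow> x |\<notin>| pFV N \<and> M = psubst N y (PFree x)" if "x \<noteq> y"
  proof
    assume eq: "bind 0 x M = bind 0 y N"
    from arg_cong[OF eq, of pFV] have x: "x |\<notin>| pFV N"
      using that by (auto simp: pFV_bind)
    with eq have "bind 0 x M = bind 0 x (psubst N y (PFree x))"
      by (simp add: bind_rename)
    with x cl show "x |\<notin>| pFV N \<and> M = psubst N y (PFree x)"
      by (simp add: bind_inject closed_at_psubst)
  qed (simp add: bind_rename)
  then show "bind 0 x M = bind 0 y N \<longleftrightarrow>
      x = y \<and> M = N \<or> x \<noteq> y \<and> x |\<notin>| pFV N \<and> M = psubst N y (PFree x)"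
    using cl by (cases "x = y") (auto simp: bind_inject)
qed

lemma lterm_inject [simp]:
  "Var x = Var y \<longleftrightarrow> x = y"
  "App M N = App M' N' \<longleftrightarrow> M = M' \<and> N = N'"
  by (transfer, simp)+

lemma lterm_distinct [simp]:
  "Var x \<noteq> App M N" "App M N \<noteq> Var x"
  "Var x \<noteq> Lam y M" "Lam y M \<noteq> Var x"
  "App M N \<noteq> Lam y P" "Lam y P \<noteq> App M N"
  by (transfer, simp)+

lemma FV_simps [simp]:
  "FV (Var x) = {|x|}"
  "FV (App M N) = FV M |\<union>| FV N"
  "FV (Lam x M) = FV M |-| {|x|}"
  by (transfer, simp add: pFV_bind)+

lemma subst_Var_App [simp]:
  "(Var y)[x ::= N] = (if y = x then N else Var y)"
  "(App M M')[x ::= N] = App (M[x ::= N]) (M'[x ::= N])"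
  by (transfer, simp)+

lemma subst_Lam: "y \<noteq> x \<Longrightarrow> y |\<notin>| FV N \<Longrightarrow> (Lam y M)[x ::= N] = Lam y (M[x ::= N])"
  by transfer (simp add: bind_psubst)

lemma subst_fresh: "x |\<notin>| FV M \<Longrightarrow> M[x ::= N] = M"
  by transfer (simp add: psubst_fresh)

text \<open>
  The bound variable in the \<open>Lam\<close> case may moreover be chosen outside any given finite set.
\<close>

lemma lterm_induct [case_names Var App Lam]:
  fixes X :: "var fset"
  assumes V: "\<And>x. P (Var x)"
    and A: "\<And>M N. P M \<Longrightarrow> P N \<Longrightarrow> P (App M N)"
    and L: "\<And>x M. x |\<notin>| X \<Longrightarrow> P M \<Longrightarrow> P (Lam x M)"
  shows "P M"
proof (induction "size (rep_lterm M)" arbitrary: M rule: less_induct)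
  case less
  have cl: "closed_at 0 (rep_lterm M)" using rep_lterm by blast
  show ?case
  proof (cases "rep_lterm M")
    case (PBound i)
    with cl show ?thesis by simp
  next
    case (PFree x)
    then have "M = Var x" by (metis Var.rep_eq rep_lterm_inject)
    with V show ?thesis by simp
  next
    case (PApp s t)
    with cl have "rep_lterm (abs_lterm s) = s" "rep_lterm (abs_lterm t) = t"
      by (auto simp: abs_lterm_inverse)
    with PApp have "M = App (abs_lterm s) (abs_lterm t)"
      "size (rep_lterm (abs_lterm s)) < size (rep_lterm M)"
      "size (rep_lterm (abs_lterm t)) < size (rep_lterm M)"
      by (auto simp: rep_lterm_inject[symmetric] App.rep_eq)
    with A less show ?thesis by simp
  next
    case (PLam t)
    obtain x where x: "x |\<notin>| X |\<union>| pFV t"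
      by (metis ex_new_if_finite finite_fset infinite_UNIV_nat)
    with PLam cl obtain s where s: "closed_at 0 s" "size s = size t" "bind 0 x s = t"
      using ex_bind[of 0 t x] by auto
    then have "rep_lterm (abs_lterm s) = s" by (simp add: abs_lterm_inverse)
    with PLam s have "M = Lam x (abs_lterm s)"
      "size (rep_lterm (abs_lterm s)) < size (rep_lterm M)"
      by (auto simp: rep_lterm_inject[symmetric] Lam.rep_eq)
    with L x less show ?thesis by simp
  qed
qed

inductive beta :: "lterm \<Rightarrow> lterm \<Rightarrow> bool" (infix "\<rhd>\<^sub>\<beta>" 50) where
  beta_redex: "App (Lam x M) N \<rhd>\<^sub>\<beta> M[x ::= N]"
| beta_Lam: "M \<rhd>\<^sub>\<beta> M' \<Longrightarrow> Lam x M \<rhd>\<^sub>\<beta> Lam x M'"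
| beta_AppL: "M \<rhd>\<^sub>\<beta> M' \<Longrightarrow> App M N \<rhd>\<^sub>\<beta> App M' N"
| beta_AppR: "N \<rhd>\<^sub>\<beta> N' \<Longrightarrow> App M N \<rhd>\<^sub>\<beta> App M N'"


section \<open>Types and environments\<close>

text \<open>
  Modulo associativity, commutativity and idempotence of \<open>\<sqinter>\<close> and neutrality of \<open>\<omega>\<close>, the types in
  \<open>\<bbbU>\<close> form the free commutative idempotent monoid on \<open>\<bbbT>\<close>, i.e. the finite subsets of \<open>\<bbbT>\<close>, with
  \<open>\<omega>\<close> the empty set, \<open>\<sqinter>\<close> union, and \<open>T \<in> \<bbbT>\<close> included in \<open>\<bbbU>\<close> as a singleton. As the recursion
  goes through \<open>fset\<close>, the quotient is also taken below arrows.
\<close>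

datatype ty = Atom nat | Arrow "ty fset" ty (infixr "\<rightarrow>\<^sub>t" 65)

type_synonym uty = "ty fset"

abbreviation omega :: uty ("\<omega>") where
  "\<omega> \<equiv> {||}"

abbreviation inter :: "uty \<Rightarrow> uty \<Rightarrow> uty" (infixl "\<sqinter>\<^sub>t" 70) where
  "U \<sqinter>\<^sub>t V \<equiv> U |\<union>| V"

abbreviation emb :: "ty \<Rightarrow> uty" ("\<langle>_\<rangle>\<^sub>t") where
  "\<langle>T\<rangle>\<^sub>t \<equiv> {|T|}"

type_synonym env = "(var, uty) fmap"

text \<open>\<open>fmupd x U \<Gamma>\<close> renders \<open>\<Gamma>, x:U\<close> wherever \<open>x |\<notin>| fmdom \<Gamma>\<close> is assumed.\<close>

context includes fmap.lifting
begin

lift_definition env_omega_on :: "var fset \<Rightarrow> env" is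
  "\<lambda>X x. if x |\<in>| X then Some \<omega> else None"
  by (simp add: dom_def)

abbreviation env_omega :: "lterm \<Rightarrow> env" where
  "env_omega M \<equiv> env_omega_on (FV M)"

lift_definition env_inter :: "env \<Rightarrow> env \<Rightarrow> env" (infixl "\<sqinter>\<^sub>e" 70) is
  "\<lambda>\<Gamma>1 \<Gamma>2 x. case (\<Gamma>1 x, \<Gamma>2 x) of
     (Some U, Some V) \<Rightarrow> Some (U \<sqinter>\<^sub>t V)
   | (Some U, None) \<Rightarrow> Some U
   | (None, V) \<Rightarrow> V"
proof -
  fix \<Gamma>1 \<Gamma>2 :: "var \<rightharpoonup> uty"
  assume "finite (dom \<Gamma>1)" "finite (dom \<Gamma>2)"
  then have "finite (dom \<Gamma>1 \<union> dom \<Gamma>2)" by simp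
  then show "finite (dom (\<lambda>x. case (\<Gamma>1 x, \<Gamma>2 x) of
     (Some U, Some V) \<Rightarrow> Some (U \<sqinter>\<^sub>t V)
   | (Some U, None) \<Rightarrow> Some U
   | (None, V) \<Rightarrow> V))"
    by (rule rev_finite_subset) (auto split: option.splits)
qed

end

text \<open>
  \<open>(++\<^sub>f)\<close> is biased to the right, so declarations of \<open>\<Gamma>\<close> are kept and the remaining variables of \<open>X\<close>
  get \<open>\<omega>\<close>. Only meaningful when \<open>fmdom \<Gamma> |\<subseteq>| X\<close>.
\<close>

definition env_lift_on :: "env \<Rightarrow> var fset \<Rightarrow> env" where
  "env_lift_on \<Gamma> X = env_omega_on X ++\<^sub>f \<Gamma>"

abbreviation env_lift :: "env \<Rightarrow> lterm \<Rightarrow> env" (infixl "\<up>" 80) where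
  "\<Gamma> \<up> M \<equiv> env_lift_on \<Gamma> (FV M)"


section \<open>Subtyping and typing\<close>

text \<open>
  The single relation \<open>\<sqsubseteq>\<close> on types, environments and typings, split by sort: no rule concludes a
  statement about types from environments or typings, nor one about environments from typings.
\<close>

inductive sub_ty :: "uty \<Rightarrow> uty \<Rightarrow> bool" (infix "\<sqsubseteq>\<^sub>t" 50) where
  sub_ty_refl: "U \<sqsubseteq>\<^sub>t U"
| sub_ty_trans: "U1 \<sqsubseteq>\<^sub>t U2 \<Longrightarrow> U2 \<sqsubseteq>\<^sub>t U3 \<Longrightarrow> U1 \<sqsubseteq>\<^sub>t U3"
| sub_ty_inter_elim: "U1 \<sqinter>\<^sub>t U2 \<sqsubseteq>\<^sub>t U1"
| sub_ty_inter: "U1 \<sqsubseteq>\<^sub>t V1 \<Longrightarrow> U2 \<sqsubseteq>\<^sub>t V2 \<Longrightarrow> U1 \<sqinter>\<^sub>t U2 \<sqsubseteq>\<^sub>t V1 \<sqinter>\<^sub>t V2"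
| sub_ty_arrow: "U2 \<sqsubseteq>\<^sub>t U1 \<Longrightarrow> \<langle>T1\<rangle>\<^sub>t \<sqsubseteq>\<^sub>t \<langle>T2\<rangle>\<^sub>t \<Longrightarrow> \<langle>U1 \<rightarrow>\<^sub>t T1\<rangle>\<^sub>t \<sqsubseteq>\<^sub>t \<langle>U2 \<rightarrow>\<^sub>t T2\<rangle>\<^sub>t"

inductive sub_env :: "env \<Rightarrow> env \<Rightarrow> bool" (infix "\<sqsubseteq>\<^sub>e" 50) where
  sub_env_refl: "\<Gamma> \<sqsubseteq>\<^sub>e \<Gamma>"
| sub_env_trans: "\<Gamma>1 \<sqsubseteq>\<^sub>e \<Gamma>2 \<Longrightarrow> \<Gamma>2 \<sqsubseteq>\<^sub>e \<Gamma>3 \<Longrightarrow> \<Gamma>1 \<sqsubseteq>\<^sub>e \<Gamma>3"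
| sub_env_upd: "U1 \<sqsubseteq>\<^sub>t U2 \<Longrightarrow> x |\<notin>| fmdom \<Gamma> \<Longrightarrow> fmupd x U1 \<Gamma> \<sqsubseteq>\<^sub>e fmupd x U2 \<Gamma>"

inductive sub_typing :: "env \<times> uty \<Rightarrow> env \<times> uty \<Rightarrow> bool" (infix "\<sqsubseteq>" 50) where
  sub_typing_refl: "\<Phi> \<sqsubseteq> \<Phi>"
| sub_typing_trans: "\<Phi>1 \<sqsubseteq> \<Phi>2 \<Longrightarrow> \<Phi>2 \<sqsubseteq> \<Phi>3 \<Longrightarrow> \<Phi>1 \<sqsubseteq> \<Phi>3"
| sub_typing_pair: "U1 \<sqsubseteq>\<^sub>t U2 \<Longrightarrow> \<Gamma>2 \<sqsubseteq>\<^sub>e \<Gamma>1 \<Longrightarrow> (\<Gamma>1, U1) \<sqsubseteq> (\<Gamma>2, U2)"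

inductive typing :: "lterm \<Rightarrow> env \<Rightarrow> uty \<Rightarrow> bool" ("_ \<Colon> \<langle>_ \<turnstile> _\<rangle>" [60, 60, 60] 50) where
  ax: "Var x \<Colon> \<langle>fmupd x \<langle>T\<rangle>\<^sub>t fmempty \<turnstile> \<langle>T\<rangle>\<^sub>t\<rangle>"
| omega: "M \<Colon> \<langle>env_omega M \<turnstile> \<omega>\<rangle>"
| arrow_i: "M \<Colon> \<langle>fmupd x U \<Gamma> \<turnstile> \<langle>T\<rangle>\<^sub>t\<rangle> \<Longrightarrow> x |\<notin>| fmdom \<Gamma> \<Longrightarrow> Lam x M \<Colon> \<langle>\<Gamma> \<turnstile> \<langle>U \<rightarrow>\<^sub>t T\<rangle>\<^sub>t\<rangle>"
| arrow_i': "M \<Colon> \<langle>\<Gamma> \<turnstile> \<langle>T\<rangle>\<^sub>t\<rangle> \<Longrightarrow> x |\<notin>| fmdom \<Gamma> \<Longrightarrow> Lam x M \<Colon> \<langle>\<Gamma> \<turnstile> \<langle>\<omega> \<rightarrow>\<^sub>t T\<rangle>\<^sub>t\<rangle>"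
| arrow_e: "M1 \<Colon> \<langle>\<Gamma>1 \<turnstile> \<langle>U \<rightarrow>\<^sub>t T\<rangle>\<^sub>t\<rangle> \<Longrightarrow> M2 \<Colon> \<langle>\<Gamma>2 \<turnstile> U\<rangle> \<Longrightarrow> App M1 M2 \<Colon> \<langle>\<Gamma>1 \<sqinter>\<^sub>e \<Gamma>2 \<turnstile> \<langle>T\<rangle>\<^sub>t\<rangle>"
| inter_i: "M \<Colon> \<langle>\<Gamma> \<turnstile> U1\<rangle> \<Longrightarrow> M \<Colon> \<langle>\<Gamma> \<turnstile> U2\<rangle> \<Longrightarrow> M \<Colon> \<langle>\<Gamma> \<turnstile> U1 \<sqinter>\<^sub>t U2\<rangle>"
| sub: "M \<Colon> \<langle>\<Gamma> \<turnstile> U\<rangle> \<Longrightarrow> (\<Gamma>, U) \<sqsubseteq> (\<Gamma>', U') \<Longrightarrow> M \<Colon> \<langle>\<Gamma>' \<turnstile> U'\<rangle>"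


text \<open>
  The side condition of \<open>\<Gamma> \<up> M\<close> is automatic for \<open>N \<Colon> \<langle>\<Gamma> \<turnstile> U\<rangle>\<close> and \<open>M \<rhd>\<^sub>\<beta> N\<close>.
\<close>

lemma fmdom_env_omega_on [simp]: "fmdom (env_omega_on X) = X"
  by (rule fset_eqI) (simp add: fmlookup_dom_iff env_omega_on.rep_eq)

lemma fmdom_env_inter [simp]: "fmdom (\<Gamma>1 \<sqinter>\<^sub>e \<Gamma>2) = fmdom \<Gamma>1 |\<union>| fmdom \<Gamma>2"
  by (rule fset_eqI) (auto simp: fmlookup_dom_iff env_inter.rep_eq split: option.splits)

lemma sub_env_fmdom: "\<Gamma> \<sqsubseteq>\<^sub>e \<Gamma>' \<Longrightarrow> fmdom \<Gamma> = fmdom \<Gamma>'"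
  by (induction rule: sub_env.induct) auto

lemma sub_typing_fmdom: "\<Phi> \<sqsubseteq> \<Phi>' \<Longrightarrow> fmdom (fst \<Phi>) = fmdom (fst \<Phi>')"
  by (induction rule: sub_typing.induct) (auto dest: sub_env_fmdom)

lemma typing_fmdom: "M \<Colon> \<langle>\<Gamma> \<turnstile> U\<rangle> \<Longrightarrow> fmdom \<Gamma> = FV M"
proof (induction rule: typing.induct)
  case (arrow_i M x U \<Gamma> T)
  from arrow_i.IH have "FV M = finsert x (fmdom \<Gamma>)" by simp
  with arrow_i.hyps show ?case by simp
next
  case (arrow_i' M \<Gamma> T x)
  then show ?case by simp
next
  case (sub M \<Gamma> U \<Gamma>' U')
  from sub_typing_fmdom[OF sub.hyps(2)] sub.IH show ?case by simp
qed simp_all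

lemma pFV_psubst: "pFV (psubst t x u) |\<subseteq>| (pFV t |-| {|x|}) |\<union>| pFV u"
  by (induction t) auto

lemma beta_FV: "M \<rhd>\<^sub>\<beta> N \<Longrightarrow> FV N |\<subseteq>| FV M"
proof (induction rule: beta.induct)
  case (beta_redex x M N)
  show ?case
    unfolding FV_simps unfolding FV.rep_eq subst.rep_eq by (rule pFV_psubst)
qed auto

lemma fmdom_subset_FV: "N \<Colon> \<langle>\<Gamma> \<turnstile> U\<rangle> \<Longrightarrow> M \<rhd>\<^sub>\<beta> N \<Longrightarrow> fmdom \<Gamma> |\<subseteq>| FV M"
  using typing_fmdom beta_FV by blast

end

theory Submission
  imports Defs
begin

text \<open>
  Environments are read as total functions that return \<open>\<omega>\<close> outside their domain; as the domain of
  a derivable typing of \<open>M\<close> is always \<open>FV M\<close>, no information is lost, and \<open>\<Gamma>\<close> and \<open>\<Gamma> \<up> M\<close> denote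
  the same function. On the locally nameless representation, typing with such environments is
  equivalent to a syntax-directed relation defined by recursion on the term, in which subsumption
  occurs only at variables. Since bound variables are indices there, no renaming is needed:
  abstracting a name moves its type from the name environment to the index environment. If
  \<open>M[x ::= N]\<close> has a type, then collecting the finitely many types that its derivation gives to the
  copies of \<open>N\<close> yields a type \<open>V\<close> of \<open>N\<close> such that \<open>M\<close> has the original type when \<open>x\<close> has type
  \<open>V\<close>, which gives the expansion of a redex.
\<close>

section \<open>Subtyping\<close>

lemma sub_ty_omega: "U \<sqsubseteq>\<^sub>t \<omega>"
  using sub_ty_inter_elim[of \<omega> U] by simp

lemma sub_ty_superset: "V |\<subseteq>| U \<Longrightarrow> U \<sqsubseteq>\<^sub>t V"
  using sub_ty_inter_elim[of V U] by (simp add: sup.absorb2)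

text \<open>The recorded shape must survive transitivity: two components are equal, or arrows
  related contravariantly on the left and covariantly on the right, and both relations compose.
  Inversion of arrow subtyping follows.\<close>

lemma sub_ty_components:
  assumes "U \<sqsubseteq>\<^sub>t V" "T |\<in>| V"
  shows "\<exists>S. S |\<in>| U \<and> \<langle>S\<rangle>\<^sub>t \<sqsubseteq>\<^sub>t \<langle>T\<rangle>\<^sub>t \<and>
    (S = T \<or> (\<exists>U1 T1 U2 T2. S = U1 \<rightarrow>\<^sub>t T1 \<and> T = U2 \<rightarrow>\<^sub>t T2 \<and>
      U2 \<sqsubseteq>\<^sub>t U1 \<and> \<langle>T1\<rangle>\<^sub>t \<sqsubseteq>\<^sub>t \<langle>T2\<rangle>\<^sub>t))"
  using assms
proof (induction arbitrary: T rule: sub_ty.induct)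
  case (sub_ty_trans U1 U2 U3)
  from sub_ty_trans.IH(2)[OF sub_ty_trans.prems] obtain S where S: "S |\<in>| U2"
    "\<langle>S\<rangle>\<^sub>t \<sqsubseteq>\<^sub>t \<langle>T\<rangle>\<^sub>t" "S = T \<or> (\<exists>U1 T1 U2 T2. S = U1 \<rightarrow>\<^sub>t T1 \<and> T = U2 \<rightarrow>\<^sub>t T2 \<and>
      U2 \<sqsubseteq>\<^sub>t U1 \<and> \<langle>T1\<rangle>\<^sub>t \<sqsubseteq>\<^sub>t \<langle>T2\<rangle>\<^sub>t)" by blast
  from sub_ty_trans.IH(1)[OF S(1)] obtain R where R: "R |\<in>| U1"
    "\<langle>R\<rangle>\<^sub>t \<sqsubseteq>\<^sub>t \<langle>S\<rangle>\<^sub>t" "R = S \<or> (\<exists>U1 T1 U2 T2. R = U1 \<rightarrow>\<^sub>t T1 \<and> S = U2 \<rightarrow>\<^sub>t T2 \<and>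
      U2 \<sqsubseteq>\<^sub>t U1 \<and> \<langle>T1\<rangle>\<^sub>t \<sqsubseteq>\<^sub>t \<langle>T2\<rangle>\<^sub>t)" by blast
  have "\<langle>R\<rangle>\<^sub>t \<sqsubseteq>\<^sub>t \<langle>T\<rangle>\<^sub>t" using R(2) S(2) by (rule sub_ty.sub_ty_trans)
  moreover have "R = T \<or> (\<exists>U1 T1 U2 T2. R = U1 \<rightarrow>\<^sub>t T1 \<and> T = U2 \<rightarrow>\<^sub>t T2 \<and>
      U2 \<sqsubseteq>\<^sub>t U1 \<and> \<langle>T1\<rangle>\<^sub>t \<sqsubseteq>\<^sub>t \<langle>T2\<rangle>\<^sub>t)"
    using R(3) S(3) by (auto intro: sub_ty.sub_ty_trans)
  ultimately show ?case using R(1) by blast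
next
  case (sub_ty_inter U1 V1 U2 V2)
  then show ?case by (metis funion_iff)
next
  case (sub_ty_arrow U2 U1 T1 T2)
  then show ?case using sub_ty.sub_ty_arrow by fastforce
qed (use sub_ty_refl in blast)+

lemma sub_ty_arrowE:
  assumes "\<langle>U \<rightarrow>\<^sub>t S\<rangle>\<^sub>t \<sqsubseteq>\<^sub>t \<langle>T\<rangle>\<^sub>t"
  obtains U' S' where "T = U' \<rightarrow>\<^sub>t S'" "U' \<sqsubseteq>\<^sub>t U" "\<langle>S\<rangle>\<^sub>t \<sqsubseteq>\<^sub>t \<langle>S'\<rangle>\<^sub>t"
  using sub_ty_components[OF assms, of T] by (auto intro: sub_ty_refl)

section \<open>Syntax-directed typing\<close>

text \<open>Only single members of \<open>ty\<close> are assigned; an intersection is handled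
  memberwise, so \<open>\<omega>\<close> becomes an empty conjunction. \<open>case_nat U h\<close>
  gives \<open>U\<close> to index 0 and shifts \<open>h\<close>.\<close>

primrec ptyping :: "preterm \<Rightarrow> (nat \<Rightarrow> uty) \<Rightarrow> (var \<Rightarrow> uty) \<Rightarrow> ty \<Rightarrow> bool" where
  "ptyping (PBound i) h g T \<longleftrightarrow> (\<exists>S. S |\<in>| h i \<and> \<langle>S\<rangle>\<^sub>t \<sqsubseteq>\<^sub>t \<langle>T\<rangle>\<^sub>t)"
| "ptyping (PFree y) h g T \<longleftrightarrow> (\<exists>S. S |\<in>| g y \<and> \<langle>S\<rangle>\<^sub>t \<sqsubseteq>\<^sub>t \<langle>T\<rangle>\<^sub>t)"
| "ptyping (PApp s t) h g T \<longleftrightarrow>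
    (\<exists>U. ptyping s h g (U \<rightarrow>\<^sub>t T) \<and> (\<forall>S. S |\<in>| U \<longrightarrow> ptyping t h g S))"
| "ptyping (PLam t) h g T \<longleftrightarrow>
    (\<exists>U S. T = U \<rightarrow>\<^sub>t S \<and> ptyping t (case_nat U h) g S)"

text \<open>Subsumption is pushed to the leaves: a smaller environment still offers a component
  below the required one, and at an abstraction \<open>U' \<sqsubseteq>\<^sub>t U\<close> turns into
  a smaller index environment.\<close>

lemma ptyping_sub:
  assumes "ptyping t h g T" "\<And>i. h' i \<sqsubseteq>\<^sub>t h i" "\<And>x. g' x \<sqsubseteq>\<^sub>t g x" "\<langle>T\<rangle>\<^sub>t \<sqsubseteq>\<^sub>t \<langle>T'\<rangle>\<^sub>t"
  shows "ptyping t h' g' T'"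
  using assms
proof (induction t arbitrary: h h' T T')
  case (PBound i)
  then show ?case
    by simp (meson sub_ty_components sub_ty_trans)
next
  case (PFree y)
  then show ?case
    by simp (meson sub_ty_components sub_ty_trans)
next
  case (PApp s t)
  from PApp.prems(1) obtain U where
    U: "ptyping s h g (U \<rightarrow>\<^sub>t T)" "\<And>S. S |\<in>| U \<Longrightarrow> ptyping t h g S" by auto
  have "ptyping s h' g' (U \<rightarrow>\<^sub>t T')"
    using PApp.IH(1)[OF U(1) PApp.prems(2,3)] PApp.prems(4) sub_ty_arrow sub_ty_refl by blast
  moreover have "ptyping t h' g' S" if "S |\<in>| U" for S
    using PApp.IH(2)[OF U(2)[OF that] PApp.prems(2,3) sub_ty_refl] .
  ultimately show ?case by auto
next
  case (PLam t)
  from PLam.prems(1) obtain U S where US: "T = U \<rightarrow>\<^sub>t S" "ptyping t (case_nat U h) g S" by auto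
  with PLam.prems(4) obtain U' S' where
    U'S': "T' = U' \<rightarrow>\<^sub>t S'" "U' \<sqsubseteq>\<^sub>t U" "\<langle>S\<rangle>\<^sub>t \<sqsubseteq>\<^sub>t \<langle>S'\<rangle>\<^sub>t"
    by (auto elim: sub_ty_arrowE)
  have "ptyping t (case_nat U' h') g' S'"
    using US(2) _ PLam.prems(3) U'S'(3)
    by (rule PLam.IH) (auto split: nat.split simp: U'S'(2) PLam.prems(2))
  with U'S'(1) show ?case by simp
qed

lemma ptyping_closed_cong:
  "closed_at k t \<Longrightarrow> (\<And>i. i < k \<Longrightarrow> h i = h' i) \<Longrightarrow> ptyping t h g T \<longleftrightarrow> ptyping t h' g T"
proof (induction t arbitrary: k h h' T)
  case (PApp s t)
  have "ptyping s h g S \<longleftrightarrow> ptyping s h' g S" "ptyping t h g S \<longleftrightarrow> ptyping t h' g S" for S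
    using PApp.IH(1)[of k h h'] PApp.IH(2)[of k h h'] PApp.prems by simp_all
  then show ?case by simp
next
  case (PLam t)
  have "ptyping t (case_nat U h) g S \<longleftrightarrow> ptyping t (case_nat U h') g S" for U S
    by (rule PLam.IH[of "Suc k"]) (use PLam.prems in \<open>auto split: nat.split\<close>)
  then show ?case by simp
qed auto

lemma ptyping_bind: "closed_at k t \<Longrightarrow> ptyping (bind k x t) h g T \<longleftrightarrow> ptyping t h (g(x := h k)) T"
  by (induction t arbitrary: k h T) auto

lemma ptyping_psubst_expand:
  assumes u: "closed_at 0 u" and "ptyping (psubst t x u) h g T"
  shows "\<exists>V. ptyping t h (g(x := V)) T \<and> (\<forall>S. S |\<in>| V \<longrightarrow> ptyping u h g S)"
  using assms(2)
proof (induction t arbitrary: h T)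
  case (PBound i)
  then show ?case by (intro exI[of _ \<omega>]) simp
next
  case (PFree y)
  show ?case
  proof (cases "y = x")
    case True
    \<comment> \<open>This occurrence of \<open>x\<close> contributes exactly the type that its copy
      of \<open>u\<close> receives; leaves other than \<open>x\<close> contribute
      \<open>\<omega>\<close>.\<close>
    with PFree show ?thesis by (intro exI[of _ "\<langle>T\<rangle>\<^sub>t"]) (auto intro: sub_ty_refl)
  next
    case False
    with PFree show ?thesis by (intro exI[of _ \<omega>]) simp
  qed
next
  case (PApp s t)
  from PApp.prems obtain U where U: "ptyping (psubst s x u) h g (U \<rightarrow>\<^sub>t T)"
    "\<And>S. S |\<in>| U \<Longrightarrow> ptyping (psubst t x u) h g S" by auto
  from PApp.IH(1)[OF U(1)] obtain V0 where
    V0: "ptyping s h (g(x := V0)) (U \<rightarrow>\<^sub>t T)" "\<And>S. S |\<in>| V0 \<Longrightarrow> ptyping u h g S" by blast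
  from PApp.IH(2)[OF U(2)] obtain W where
    W: "\<And>S. S |\<in>| U \<Longrightarrow> ptyping t h (g(x := W S)) S"
       "\<And>S R. S |\<in>| U \<Longrightarrow> R |\<in>| W S \<Longrightarrow> ptyping u h g R" by metis
  \<comment> \<open>The argument is typed once for each \<open>S\<close> in \<open>U\<close>, each
    time with its own \<open>W S\<close>; since \<open>U\<close> is finite, one union covers all of
    them. A larger set is a smaller type, so \<open>ptyping_sub\<close> carries every derivation
    over to \<open>V\<close>.\<close>
  define V where "V = V0 |\<union>| ffUnion (W |`| U)"
  have "ptyping s h (g(x := V)) (U \<rightarrow>\<^sub>t T)"
    by (rule ptyping_sub[OF V0(1)]) (auto simp: V_def intro: sub_ty_refl sub_ty_superset)
  moreover have "ptyping t h (g(x := V)) S" if "S |\<in>| U" for S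
  proof (rule ptyping_sub[OF W(1)[OF that]])
    have "W S |\<subseteq>| ffUnion (W |`| U)" using that by (auto simp: ffUnion.rep_eq)
    then have "W S |\<subseteq>| V" by (auto simp: V_def)
    then show "(g(x := V)) y \<sqsubseteq>\<^sub>t (g(x := W S)) y" for y
      by (auto intro: sub_ty_refl sub_ty_superset)
  qed (rule sub_ty_refl)+
  moreover have "ptyping u h g S" if "S |\<in>| V" for S
    using that V0(2) W(2) by (auto simp: V_def ffUnion.rep_eq)
  ultimately show ?case
    unfolding ptyping.simps by blast
next
  case (PLam t)
  from PLam.prems obtain U S where US: "T = U \<rightarrow>\<^sub>t S"
    "ptyping (psubst t x u) (case_nat U h) g S" by auto
  from PLam.IH[OF US(2)] obtain V where
    V: "ptyping t (case_nat U h) (g(x := V)) S"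
       "\<And>S. S |\<in>| V \<Longrightarrow> ptyping u (case_nat U h) g S" by blast
  \<comment> \<open>Being locally closed, \<open>u\<close> reads no index, so its types under the
    binder are also its types outside.\<close>
  have "ptyping u (case_nat U h) g R \<longleftrightarrow> ptyping u h g R" for R
    by (rule ptyping_closed_cong[OF u]) simp
  with V US(1) show ?case unfolding ptyping.simps by blast
qed

text \<open>The constant \<open>\<omega>\<close> is a default: a locally closed representative never
  reads the index environment.\<close>

definition has_type :: "lterm \<Rightarrow> (var \<Rightarrow> uty) \<Rightarrow> ty \<Rightarrow> bool" where
  "has_type M g T \<longleftrightarrow> ptyping (rep_lterm M) (\<lambda>_. \<omega>) g T"

lemma closed_rep: "closed_at 0 (rep_lterm M)"
  using rep_lterm by blast

lemma has_type_Var: "has_type (Var x) g T \<longleftrightarrow> (\<exists>S. S |\<in>| g x \<and> \<langle>S\<rangle>\<^sub>t \<sqsubseteq>\<^sub>t \<langle>T\<rangle>\<^sub>t)"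
  by (simp add: has_type_def Var.rep_eq)

lemma has_type_App: "has_type (App M N) g T \<longleftrightarrow>
    (\<exists>U. has_type M g (U \<rightarrow>\<^sub>t T) \<and> (\<forall>S. S |\<in>| U \<longrightarrow> has_type N g S))"
  by (simp add: has_type_def App.rep_eq)

lemma has_type_Lam: "has_type (Lam x M) g T \<longleftrightarrow>
    (\<exists>U S. T = U \<rightarrow>\<^sub>t S \<and> has_type M (g(x := U)) S)"
proof -
  have "ptyping (bind 0 x (rep_lterm M)) (case_nat U (\<lambda>_. \<omega>)) g S \<longleftrightarrow>
      has_type M (g(x := U)) S" for U S
    unfolding has_type_def ptyping_bind[OF closed_rep] nat.case
    by (rule ptyping_closed_cong[OF closed_rep]) simp
  then show ?thesis
    by (simp add: has_type_def[of "Lam x M"] Lam.rep_eq)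
qed

lemma has_type_sub:
  "has_type M g T \<Longrightarrow> (\<And>x. g' x \<sqsubseteq>\<^sub>t g x) \<Longrightarrow> \<langle>T\<rangle>\<^sub>t \<sqsubseteq>\<^sub>t \<langle>T'\<rangle>\<^sub>t \<Longrightarrow> has_type M g' T'"
  unfolding has_type_def by (erule ptyping_sub) (auto intro: sub_ty_refl)

lemma has_type_expansion: "M \<rhd>\<^sub>\<beta> N \<Longrightarrow> has_type N g T \<Longrightarrow> has_type M g T"
proof (induction arbitrary: g T rule: beta.induct)
  case (beta_redex x M N)
  then have "ptyping (psubst (rep_lterm M) x (rep_lterm N)) (\<lambda>_. \<omega>) g T"
    by (simp add: has_type_def subst.rep_eq)
  from ptyping_psubst_expand[OF closed_rep this]
  \<comment> \<open>The type \<open>V\<close> obtained for \<open>N\<close> is both the argument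
    type in the application and the type of \<open>x\<close> in the abstraction.\<close>
  show ?case by (auto simp: has_type_App has_type_Lam simp flip: has_type_def)
next
  case (beta_Lam M M' x)
  then show ?case by (fastforce simp: has_type_Lam)
next
  case (beta_AppL M M' N)
  then show ?case by (fastforce simp: has_type_App)
next
  case (beta_AppR N N' M)
  then show ?case by (fastforce simp: has_type_App)
qed

section \<open>Environments as total functions\<close>

definition lookup_env :: "env \<Rightarrow> var \<Rightarrow> uty" where
  "lookup_env \<Gamma> x = (case fmlookup \<Gamma> x of None \<Rightarrow> \<omega> | Some U \<Rightarrow> U)"

context includes fmap.lifting
begin

text \<open>This goes back from functions to finite environments, undoing \<open>lookup_env\<close>
  when \<open>X\<close> is the domain.\<close>

lift_definition restrict_env :: "(var \<Rightarrow> uty) \<Rightarrow> var fset \<Rightarrow> env" is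
  "\<lambda>g X x. if x |\<in>| X then Some (g x) else None"
  by (simp add: dom_def)

end

lemma fmdom_restrict_env [simp]: "fmdom (restrict_env g X) = X"
  by (rule fset_eqI) (simp add: fmlookup_dom_iff restrict_env.rep_eq)

lemma restrict_env_finsert: "restrict_env g (finsert x X) = fmupd x (g x) (restrict_env g X)"
  by (rule fmap_ext) (auto simp: restrict_env.rep_eq)

lemma env_omega_on_eq: "env_omega_on X = restrict_env (\<lambda>_. \<omega>) X"
  by (rule fmap_ext) (simp add: restrict_env.rep_eq env_omega_on.rep_eq)

text \<open>By idempotence of intersection on shared variables, one function can serve both premises
  of \<open>arrow_e\<close>.\<close>

lemma env_inter_restrict:
  "restrict_env g X \<sqinter>\<^sub>e restrict_env g Y = restrict_env g (X |\<union>| Y)"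
  by (rule fmap_ext) (auto simp: restrict_env.rep_eq env_inter.rep_eq)

lemma env_lift_on_eq: "fmdom \<Gamma> |\<subseteq>| X \<Longrightarrow> env_lift_on \<Gamma> X = restrict_env (lookup_env \<Gamma>) X"
  by (rule fmap_ext)
    (auto simp: env_lift_on_def restrict_env.rep_eq env_omega_on.rep_eq lookup_env_def
      fmlookup_dom_iff split: option.split)

lemma lookup_env_fmupd: "lookup_env (fmupd x U \<Gamma>) = (lookup_env \<Gamma>)(x := U)"
  by (rule ext) (simp add: lookup_env_def)

lemma lookup_env_notin: "x |\<notin>| fmdom \<Gamma> \<Longrightarrow> (lookup_env \<Gamma>)(x := \<omega>) = lookup_env \<Gamma>"
  by (rule ext) (simp add: lookup_env_def fmdom_notD)

lemma lookup_env_inter: "lookup_env (\<Gamma>1 \<sqinter>\<^sub>e \<Gamma>2) x = lookup_env \<Gamma>1 x \<sqinter>\<^sub>t lookup_env \<Gamma>2 x"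
  by (simp add: lookup_env_def env_inter.rep_eq split: option.split)

lemma lookup_env_mono: "\<Gamma> \<sqsubseteq>\<^sub>e \<Gamma>' \<Longrightarrow> lookup_env \<Gamma> x \<sqsubseteq>\<^sub>t lookup_env \<Gamma>' x"
  by (induction rule: sub_env.induct) (auto simp: lookup_env_fmupd intro: sub_ty.intros)

text \<open>The environment rule changes one declaration over a common remainder; distinct updates
  commute, so \<open>x\<close> can be moved into that remainder.\<close>

lemma sub_env_fmupd_cong:
  "\<Gamma> \<sqsubseteq>\<^sub>e \<Gamma>' \<Longrightarrow> x |\<notin>| fmdom \<Gamma> \<Longrightarrow> fmupd x U \<Gamma> \<sqsubseteq>\<^sub>e fmupd x U \<Gamma>'"
proof (induction rule: sub_env.induct)
  case (sub_env_trans \<Gamma>1 \<Gamma>2 \<Gamma>3)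
  then show ?case using sub_env_fmdom sub_env.sub_env_trans by metis
next
  case (sub_env_upd U1 U2 y \<Gamma>)
  then have "fmupd y U1 (fmupd x U \<Gamma>) \<sqsubseteq>\<^sub>e fmupd y U2 (fmupd x U \<Gamma>)"
    by (intro sub_env.sub_env_upd) auto
  with sub_env_upd.prems show ?case by (simp add: fmupd_reorder_neq)
qed (rule sub_env_refl)

lemma restrict_env_mono:
  "(\<And>x. x |\<in>| X \<Longrightarrow> g x \<sqsubseteq>\<^sub>t g' x) \<Longrightarrow> restrict_env g X \<sqsubseteq>\<^sub>e restrict_env g' X"
proof (induction X)
  case empty
  have "restrict_env g {||} = restrict_env g' {||}" by (rule fmap_ext) (simp add: restrict_env.rep_eq)
  then show ?case by (simp add: sub_env_refl)
next
  case (insert x X)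
  have "fmupd x (g x) (restrict_env g X) \<sqsubseteq>\<^sub>e fmupd x (g x) (restrict_env g' X)"
    using insert by (intro sub_env_fmupd_cong) auto
  moreover have "fmupd x (g x) (restrict_env g' X) \<sqsubseteq>\<^sub>e fmupd x (g' x) (restrict_env g' X)"
    using insert by (intro sub_env_upd) auto
  ultimately show ?case unfolding restrict_env_finsert by (rule sub_env_trans)
qed

section \<open>Equivalence of the two typing relations\<close>

lemma sub_typing_components:
  "\<Phi> \<sqsubseteq> \<Phi>' \<Longrightarrow> snd \<Phi> \<sqsubseteq>\<^sub>t snd \<Phi>' \<and> fst \<Phi>' \<sqsubseteq>\<^sub>e fst \<Phi>"
  by (induction rule: sub_typing.induct) (auto intro: sub_ty.intros sub_env.intros)

lemma typing_imp_has_type: "M \<Colon> \<langle>\<Gamma> \<turnstile> U\<rangle> \<Longrightarrow> T |\<in>| U \<Longrightarrow> has_type M (lookup_env \<Gamma>) T"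
proof (induction arbitrary: T rule: typing.induct)
  case (ax x T')
  then show ?case by (simp add: has_type_Var lookup_env_fmupd sub_ty_refl)
next
  case (omega M)
  then show ?case by simp
next
  case (arrow_i M x U \<Gamma> T')
  then show ?case by (simp add: has_type_Lam flip: lookup_env_fmupd)
next
  case (arrow_i' M \<Gamma> T' x)
  \<comment> \<open>Outside the domain the lookup is already \<open>\<omega>\<close>, so declaring
    \<open>x\<close> with type \<open>\<omega>\<close> changes nothing.\<close>
  then show ?case by (simp add: has_type_Lam lookup_env_notin)
next
  case (arrow_e M1 \<Gamma>1 U T' M2 \<Gamma>2)
  have "has_type M1 (lookup_env (\<Gamma>1 \<sqinter>\<^sub>e \<Gamma>2)) (U \<rightarrow>\<^sub>t T')"
    using arrow_e.IH(1)[of "U \<rightarrow>\<^sub>t T'"]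
    by (rule has_type_sub) (auto simp: lookup_env_inter intro: sub_ty_refl sub_ty_superset)
  moreover have "has_type M2 (lookup_env (\<Gamma>1 \<sqinter>\<^sub>e \<Gamma>2)) S" if "S |\<in>| U" for S
    using arrow_e.IH(2)[OF that]
    by (rule has_type_sub) (auto simp: lookup_env_inter intro: sub_ty_refl sub_ty_superset)
  ultimately show ?case using arrow_e.prems by (auto simp: has_type_App)
next
  case (inter_i M \<Gamma> U1 U2)
  then show ?case by auto
next
  case (sub M \<Gamma> U \<Gamma>' U')
  from sub_typing_components[OF sub.hyps(2)] have le: "U \<sqsubseteq>\<^sub>t U'" "\<Gamma>' \<sqsubseteq>\<^sub>e \<Gamma>" by simp_all
  from sub_ty_components[OF le(1) sub.prems] obtain S where "S |\<in>| U" "\<langle>S\<rangle>\<^sub>t \<sqsubseteq>\<^sub>t \<langle>T\<rangle>\<^sub>t" by blast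
  then show ?case using sub.IH lookup_env_mono[OF le(2)] has_type_sub by blast
qed

lemma typing_fset:
  assumes "\<And>T. T |\<in>| U \<Longrightarrow> M \<Colon> \<langle>restrict_env g (FV M) \<turnstile> \<langle>T\<rangle>\<^sub>t\<rangle>"
  shows "M \<Colon> \<langle>restrict_env g (FV M) \<turnstile> U\<rangle>"
  using assms
proof (induction U)
  case empty
  \<comment> \<open>The rule \<open>omega\<close> yields only the environment that is
    \<open>\<omega>\<close> throughout; any other on the same domain lies below it.\<close>
  have "restrict_env g (FV M) \<sqsubseteq>\<^sub>e env_omega M"
    unfolding env_omega_on_eq by (rule restrict_env_mono) (rule sub_ty_omega)
  then show ?case by (intro sub[OF omega] sub_typing_pair sub_ty_refl)
next
  case (insert T U)
  then have "M \<Colon> \<langle>restrict_env g (FV M) \<turnstile> \<langle>T\<rangle>\<^sub>t \<sqinter>\<^sub>t U\<rangle>" by (intro inter_i) auto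
  then show ?case by simp
qed

lemma has_type_imp_typing: "has_type M g T \<Longrightarrow> M \<Colon> \<langle>restrict_env g (FV M) \<turnstile> \<langle>T\<rangle>\<^sub>t\<rangle>"
proof (induction M arbitrary: g T rule: lterm_induct[where X = "{||}"])
  case (Var x)
  then obtain S where S: "S |\<in>| g x" "\<langle>S\<rangle>\<^sub>t \<sqsubseteq>\<^sub>t \<langle>T\<rangle>\<^sub>t" by (auto simp: has_type_Var)
  have "g x \<sqsubseteq>\<^sub>t \<langle>S\<rangle>\<^sub>t" using S(1) by (intro sub_ty_superset) auto
  moreover have "restrict_env g {|x|} = fmupd x (g x) fmempty"
    by (rule fmap_ext) (simp add: restrict_env.rep_eq)
  ultimately have "restrict_env g (FV (Var x)) \<sqsubseteq>\<^sub>e fmupd x \<langle>S\<rangle>\<^sub>t fmempty"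
    by (simp add: sub_env_upd)
  with S(2) show ?case by (intro sub[OF ax] sub_typing_pair)
next
  case (App M N)
  then obtain U where U: "has_type M g (U \<rightarrow>\<^sub>t T)" "\<And>S. S |\<in>| U \<Longrightarrow> has_type N g S"
    by (auto simp: has_type_App)
  have "N \<Colon> \<langle>restrict_env g (FV N) \<turnstile> U\<rangle>" by (rule typing_fset) (rule App.IH(2)[OF U(2)])
  from arrow_e[OF App.IH(1)[OF U(1)] this] show ?case by (simp add: env_inter_restrict)
next
  case (Lam x M)
  then obtain U S where US: "T = U \<rightarrow>\<^sub>t S" "has_type M (g(x := U)) S"
    by (auto simp: has_type_Lam)
  from Lam.IH[OF US(2)] have M: "M \<Colon> \<langle>restrict_env (g(x := U)) (FV M) \<turnstile> \<langle>S\<rangle>\<^sub>t\<rangle>" .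
  show ?case
  proof (cases "x |\<in>| FV M")
    case True
    then have "restrict_env (g(x := U)) (FV M) = fmupd x U (restrict_env g (FV M |-| {|x|}))"
      by (intro fmap_ext) (auto simp: restrict_env.rep_eq)
    with M have "Lam x M \<Colon> \<langle>restrict_env g (FV M |-| {|x|}) \<turnstile> \<langle>U \<rightarrow>\<^sub>t S\<rangle>\<^sub>t\<rangle>"
      by (intro arrow_i) auto
    with US(1) show ?thesis by simp
  next
    case False
    then have "restrict_env (g(x := U)) (FV M) = restrict_env g (FV (Lam x M))"
      by (intro fmap_ext) (auto simp: restrict_env.rep_eq)
    with M False have "Lam x M \<Colon> \<langle>restrict_env g (FV (Lam x M)) \<turnstile> \<langle>\<omega> \<rightarrow>\<^sub>t S\<rangle>\<^sub>t\<rangle>"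
      by (intro arrow_i') auto
    \<comment> \<open>As \<open>x\<close> is not free in \<open>M\<close>, \<open>arrow_i'\<close>
      yields an arrow from \<open>\<omega>\<close>; contravariance and
      \<open>U \<sqsubseteq>\<^sub>t \<omega>\<close> then give the arrow from
      \<open>U\<close>.\<close>
    then show ?thesis unfolding US(1)
      by (rule sub) (intro sub_typing_pair sub_ty_arrow sub_ty_omega sub_ty_refl sub_env_refl)
  qed
qed

theorem theorem3p11:
  fixes M N :: lterm and \<Gamma> :: env and U :: uty
  assumes "N \<Colon> \<langle>\<Gamma> \<turnstile> U\<rangle>"
    and "M \<rhd>\<^sub>\<beta> N"
  shows "M \<Colon> \<langle>\<Gamma> \<up> M \<turnstile> U\<rangle>"
  unfolding env_lift_on_eq[OF fmdom_subset_FV[OF assms]]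
  by (rule typing_fset, rule has_type_imp_typing, rule has_type_expansion[OF assms(2)],
    rule typing_imp_has_type[OF assms(1)])

end
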